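(* Let $Y$ be a nontrivial real Banach space. If $\mathrm{SNA}(X,Y)\cup \mathrm{Der}(X,Y)$ is dense in $\mathrm{Lip}_0(X,Y)$ for some nontrivial real Banach space $X$, then $Y$ has the extremal RNP.
   Context: For real Banach spaces $X,Y$, $\mathrm{Lip}_0(X,Y)$ denotes the space of Lipschitz maps $f:X\to Y$ with $f(0)=0$, equipped with the Lipschitz norm $\|f\| = \sup\{\|f(p)-f(q)\|/\|p-q\| : p,q\in X,\ p\neq q\}$; density is with respect to this norm. $S_X$ denotes the unit sphere of $X$. $f\in \mathrm{Lip}_0(X,Y)$ strongly attains its norm, written $f\in \mathrm{SNA}(X,Y)$, if there exist $p\neq q$ in $X$ with $\|f\| = \|f(p)-f(q)\|/\|p-q\|$. $f\in \mathrm{Lip}_0(X,Y)$ attains its maximal derivative, written $f\in \mathrm{Der}(X,Y)$, if there exist $x\in X$ and $e\in S_X$ such that the (two-sided, norm) limit $f'(x,e) := \lim_{t\to 0} \frac{f(x+te)-f(x)}{t}\in Y$ exists and $\|f'(x,e)\| = \|f\|$. A bounded set $D\subseteq Y$ is dentable if for every $\varepsilon>0$ there is $y\in D$ with $y\notin \overline{\mathrm{co}}(D\setminus B(y,\varepsilon))$, where $B(y,\varepsilon)$ is the open ball and $\overline{\mathrm{co}}$ the closed convex hull. For a bounded convex set $D\subseteq Y$, a point $z\in D$ is a farthest point of $D$ if there exists $x\in Y$ with $\|z-x\| = \sup_{y\in D}\|y-x\|$. A Banach space $Y$ has the extremal RNP if every bounded closed convex subset of $Y$ which contains a farthest point is dentable.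 *)

theory Defs
  imports "HOL-Analysis.Analysis"
begin

definition Lip0 :: "('a::real_normed_vector \<Rightarrow> 'b::real_normed_vector) set" where
  "Lip0 = {f. (\<exists>L. L-lipschitz_on UNIV f) \<and> f 0 = 0}"

text \<open>
  The supremum is taken in the reals. The set is bounded above when \<open>f\<close> is Lipschitz, and nonempty
  when the domain is nontrivial; outside these cases the value is unspecified.
\<close>
definition lip_norm :: "('a::real_normed_vector \<Rightarrow> 'b::real_normed_vector) \<Rightarrow> real" where
  "lip_norm f = Sup {norm (f p - f q) / norm (p - q) | p q. p \<noteq> q}"

definition SNA :: "('a::real_normed_vector \<Rightarrow> 'b::real_normed_vector) set" where
  "SNA = {f \<in> Lip0. \<exists>p q. p \<noteq> q \<and> lip_norm f = norm (f p - f q) / norm (p - q)}"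

text \<open>The limit is two-sided, over real \<open>t \<noteq> 0\<close>, in the norm topology of the target space.\<close>
definition Der :: "('a::real_normed_vector \<Rightarrow> 'b::real_normed_vector) set" where
  "Der = {f \<in> Lip0. \<exists>x e l. norm e = 1 \<and>
            ((\<lambda>t::real. (f (x + t *\<^sub>R e) - f x) /\<^sub>R t) \<longlongrightarrow> l) (at 0) \<and>
            norm l = lip_norm f}"

definition dense_in_Lip0 :: "('a::real_normed_vector \<Rightarrow> 'b::real_normed_vector) set \<Rightarrow> bool" where
  "dense_in_Lip0 A \<longleftrightarrow>
     A \<subseteq> Lip0 \<and> (\<forall>f\<in>Lip0. \<forall>\<epsilon>>0. \<exists>g\<in>A. lip_norm (\<lambda>x. f x - g x) < \<epsilon>)"

definition dentable :: "'b::real_normed_vector set \<Rightarrow> bool" where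
  "dentable D \<longleftrightarrow>
     bounded D \<and> (\<forall>\<epsilon>>0. \<exists>y\<in>D. y \<notin> closure (convex hull (D - ball y \<epsilon>)))"

text \<open>Meaningful for bounded \<open>D\<close> only, since the supremum is taken in the reals.\<close>
definition farthest_point :: "'b::real_normed_vector set \<Rightarrow> 'b \<Rightarrow> bool" where
  "farthest_point D z \<longleftrightarrow> z \<in> D \<and> (\<exists>x. norm (z - x) = (SUP y\<in>D. norm (y - x)))"

definition extremal_RNP :: "'b::banach itself \<Rightarrow> bool" where
  "extremal_RNP _ \<longleftrightarrow>
     (\<forall>D::'b set. bounded D \<and> closed D \<and> convex D \<and> (\<exists>z. farthest_point D z) \<longrightarrow> dentable D)"

end

theory Submission
  imports Defs
begin

text \<open>
  If a bounded nonempty set \<open>D\<close> is not dentable, then in a small neighbourhood \<open>U\<close> of \<open>D\<close> every point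
  \<open>d\<close> is a combination \<open>w\<^sub>1 c\<^sub>1 + \<dots> + w\<^sub>n c\<^sub>n\<close> of points \<open>c\<^sub>i\<close> of \<open>U\<close> that are \<open>\<epsilon>\<close>-far from \<open>d\<close>, with
  positive weights of total mass less than \<open>1\<close>. Subdividing \<open>[0, 1]\<close> accordingly and repeating this
  inside each piece yields a Lipschitz curve \<open>F\<close> from \<open>0\<close> to \<open>d\<close> whose mean slopes over nested pieces
  oscillate by \<open>\<epsilon>\<close> at all scales, so that \<open>F\<close> has no approximate derivative anywhere. The missing mass
  leaves a gap in each piece on which \<open>F\<close> is constant, so that \<open>F\<close> is injective on no interval.
  Choose \<open>d\<close> of almost maximal norm in \<open>U\<close> and put \<open>f x = F \<parallel>x\<parallel>\<close>. A map \<open>g\<close> close to \<open>f\<close> with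
  \<open>g \<in> SNA\<close> would force \<open>F\<close> to be injective on an interval, and \<open>g \<in> Der\<close> would give \<open>F\<close> an approximate
  derivative.
\<close>

section \<open>Curves glued from rescaled pieces\<close>

definition width :: "(real \<times> 'b) list \<Rightarrow> real" where
  "width L = sum_list (map fst L)"

lemma width_simps [simp]: "width [] = 0" "width (p # L) = fst p + width L"
  "width (L @ M) = width L + width M"
  by (auto simp: width_def)

text \<open>\<open>g d\<close> is scaled by \<open>w\<close> in domain and range and started where
  the previous piece ended. A plain sum does this, because the curves to be glued vanish to the left
  of [0, 1] and are constant to the right of it.\<close>

fun glue :: "('b \<Rightarrow> real \<Rightarrow> 'b) \<Rightarrow> (real \<times> 'b) list \<Rightarrow> real \<Rightarrow> 'b::real_normed_vector" where
  "glue g [] x = 0"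
| "glue g ((w, d) # L) x = w *\<^sub>R g d (x / w) + glue g L (x - w)"

definition profile :: "real \<Rightarrow> 'b \<Rightarrow> (real \<Rightarrow> 'b::real_normed_vector) \<Rightarrow> bool" where
  "profile R d g \<longleftrightarrow>
     (\<forall>x\<le>0. g x = 0) \<and> (\<forall>x\<ge>1. g x = d) \<and> (\<forall>x y. x \<le> y \<longrightarrow> norm (g y - g x) \<le> R * (y - x))"

lemma profile_left: "profile R d g \<Longrightarrow> x \<le> 0 \<Longrightarrow> g x = 0"
  and profile_right: "profile R d g \<Longrightarrow> 1 \<le> x \<Longrightarrow> g x = d"
  and profile_lipschitz: "profile R d g \<Longrightarrow> x \<le> y \<Longrightarrow> norm (g y - g x) \<le> R * (y - x)"
  by (auto simp: profile_def)

lemma profile_lipschitz_abs: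
  assumes "profile R d g"
  shows "norm (g x - g y) \<le> R * \<bar>x - y\<bar>"
  using profile_lipschitz[OF assms, of x y] profile_lipschitz[OF assms, of y x]
  by (cases "x \<le> y") (auto simp: norm_minus_commute)

definition gluable :: "real \<Rightarrow> ('b \<Rightarrow> real \<Rightarrow> 'b::real_normed_vector) \<Rightarrow> (real \<times> 'b) list \<Rightarrow> bool" where
  "gluable R g L \<longleftrightarrow> (\<forall>(w, d)\<in>set L. 0 < w \<and> profile R d (g d))"

lemma gluable_simps [simp]: "gluable R g []"
  "gluable R g ((w, d) # L) \<longleftrightarrow> 0 < w \<and> profile R d (g d) \<and> gluable R g L"
  "gluable R g (L @ M) \<longleftrightarrow> gluable R g L \<and> gluable R g M"
  by (auto simp: gluable_def)

lemma width_nonneg: "gluable R g L \<Longrightarrow> 0 \<le> width L"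
  by (induction L) auto

lemma glue_left: "gluable R g L \<Longrightarrow> x \<le> 0 \<Longrightarrow> glue g L x = 0"
  by (induction L arbitrary: x) (auto simp: profile_left divide_nonpos_pos)

lemma glue_right:
  "gluable R g L \<Longrightarrow> width L \<le> x \<Longrightarrow> glue g L x = (\<Sum>(w, d)\<leftarrow>L. w *\<^sub>R d)"
proof (induction L arbitrary: x)
  case (Cons p L)
  obtain w d where p: "p = (w, d)" by (cases p)
  have "w \<le> x" using Cons.prems width_nonneg[of R g L] by (auto simp: p)
  then have "g d (x / w) = d" using Cons.prems by (auto simp: p intro: profile_right)
  then show ?case using Cons by (auto simp: p)
qed simp

lemma glue_append: "glue g (L @ M) x = glue g L x + glue g M (x - width L)"
  by (induction L arbitrary: x) (auto simp: algebra_simps)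

text \<open>Scaling both axes by \<open>w\<close> preserves slopes. Left of \<open>w\<close> only
  the first summand moves, right of \<open>w\<close> only the others do; the two estimates are
  joined at \<open>w\<close>.\<close>

lemma glue_lipschitz:
  "gluable R g L \<Longrightarrow> x \<le> y \<Longrightarrow> 0 \<le> R \<Longrightarrow> norm (glue g L y - glue g L x) \<le> R * (y - x)"
proof (induction L arbitrary: x y)
  case (Cons p L)
  obtain w d where p: "p = (w, d)" by (cases p)
  have w: "w > 0" and P: "profile R d (g d)" and L: "gluable R g L"
    using Cons.prems by (auto simp: p)
  have first: "norm (w *\<^sub>R g d (t / w) - w *\<^sub>R g d (s / w)) \<le> R * (t - s)" if "s \<le> t" for s t
  proof -
    have "norm (w *\<^sub>R g d (t / w) - w *\<^sub>R g d (s / w)) = w * norm (g d (t / w) - g d (s / w))"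
      using w by (simp flip: scaleR_diff_right)
    also have "\<dots> \<le> w * (R * (t / w - s / w))"
      using w that by (intro mult_left_mono profile_lipschitz[OF P] divide_right_mono) auto
    also have "\<dots> = R * (t - s)" using w by (simp add: field_simps)
    finally show ?thesis .
  qed
  have low: "norm (glue g (p # L) t - glue g (p # L) s) \<le> R * (t - s)" if "s \<le> t" "t \<le> w" for s t
    using first[OF that(1)] that glue_left[OF L, of "t - w"] glue_left[OF L, of "s - w"]
    by (simp add: p)
  have high: "norm (glue g (p # L) t - glue g (p # L) s) \<le> R * (t - s)" if "s \<le> t" "w \<le> s" for s t
  proof -
    have "g d (t / w) = d" "g d (s / w) = d" using that w by (auto intro!: profile_right[OF P])
    then show ?thesis using Cons.IH[OF L, of "s - w" "t - w"] Cons.prems(3) that by (simp add: p)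
  qed
  consider "y \<le> w" | "w \<le> x" | "x \<le> w" "w \<le> y" by linarith
  then show ?case
  proof cases
    case 3
    have "norm (glue g (p # L) y - glue g (p # L) x)
        \<le> norm (glue g (p # L) y - glue g (p # L) w) + norm (glue g (p # L) w - glue g (p # L) x)"
      using norm_triangle_ineq[of "glue g (p # L) y - glue g (p # L) w" "glue g (p # L) w - glue g (p # L) x"]
      by (simp del: glue.simps)
    also have "\<dots> \<le> R * (y - w) + R * (w - x)" using 3 by (intro add_mono low high) auto
    finally show ?thesis by (simp del: glue.simps add: algebra_simps)
  qed (use low high Cons.prems in auto)
qed simp

text \<open>At any \<open>x\<close> at most one piece contributes to the difference: pieces not yet
  begun vanish, and completed ones have the same value for both families. There the error is scaled
  by \<open>w\<close>, at most 1/2, which makes gluing a contraction.\<close>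

lemma glue_dist:
  assumes "gluable R g L" "gluable R h L"
    and "\<And>w d. (w, d) \<in> set L \<Longrightarrow> w \<le> 1 / 2"
    and "\<And>w d x. (w, d) \<in> set L \<Longrightarrow> norm (g d x - h d x) \<le> B"
    and "0 \<le> B"
  shows "norm (glue g L x - glue h L x) \<le> B / 2"
  using assms
proof (induction L arbitrary: x)
  case (Cons p L)
  obtain w d where p: "p = (w, d)" by (cases p)
  have w: "w > 0" and P: "profile R d (g d)" "profile R d (h d)" and L: "gluable R g L" "gluable R h L"
    using Cons.prems by (auto simp: p)
  show ?case
  proof (cases "x \<le> w")
    case True
    then have "norm (glue g (p # L) x - glue h (p # L) x) = norm (w *\<^sub>R (g d (x / w) - h d (x / w)))"
      using glue_left[OF L(1), of "x - w"] glue_left[OF L(2), of "x - w"]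
      by (simp add: p scaleR_diff_right)
    also have "\<dots> \<le> 1 / 2 * B"
      unfolding norm_scaleR using w Cons.prems(3,5) Cons.prems(4)[of w d]
      by (intro mult_mono) (auto simp: p)
    finally show ?thesis by simp
  next
    case False
    then have "g d (x / w) = d" "h d (x / w) = d" using w by (auto intro!: P[THEN profile_right])
    moreover have "norm (glue g L (x - w) - glue h L (x - w)) \<le> B / 2"
      by (rule Cons.IH[OF L]) (meson list.set_intros(2) Cons.prems)+
    ultimately show ?thesis by (simp add: p)
  qed
qed simp

text \<open>On its own interval a piece is the only summand that moves, since earlier ones are
  complete and later ones still vanish.\<close>

lemma glue_piece:
  assumes "gluable R g (L @ (w, d) # M)" "0 \<le> y" "y \<le> 1"
  shows "glue g (L @ (w, d) # M) (width L + w * y) = glue g (L @ (w, d) # M) (width L) + w *\<^sub>R g d y"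
proof -
  have w: "w > 0" and P: "profile R d (g d)" and L: "gluable R g L" and M: "gluable R g M"
    using assms by auto
  have "w * y \<le> w" using assms w by (simp add: mult_left_le)
  then have "glue g M (w * y - w) = 0" "glue g M (- w) = 0"
    using w by (auto intro!: glue_left[OF M])
  moreover have "glue g L (width L + w * y) = glue g L (width L)"
    using w assms by (simp add: glue_right[OF L])
  ultimately show ?thesis using w profile_left[OF P, of 0] by (simp add: glue_append)
qed

lemma piece_containing:
  assumes "gluable R g L" "0 \<le> x" "x < width L"
  shows "\<exists>L1 w d L2. L = L1 @ (w, d) # L2 \<and> width L1 \<le> x \<and> x \<le> width L1 + w"
  using assms
proof (induction L arbitrary: x)
  case (Cons p L)
  obtain w d where p: "p = (w, d)" by (cases p)
  show ?case
  proof (cases "x \<le> w")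
    case True
    then have "p # L = [] @ (w, d) # L \<and> width ([] :: (real \<times> 'a) list) \<le> x \<and> x \<le> width ([] :: (real \<times> 'a) list) + w"
      using Cons.prems by (simp add: p)
    then show ?thesis by blast
  next
    case False
    then obtain L1 w' d' L2 where "L = L1 @ (w', d') # L2" "width L1 \<le> x - w" "x - w \<le> width L1 + w'"
      using Cons.IH[of "x - w"] Cons.prems by (auto simp: p)
    then have "p # L = (p # L1) @ (w', d') # L2 \<and> width (p # L1) \<le> x \<and> x \<le> width (p # L1) + w'"
      by (simp add: p)
    then show ?thesis by blast
  qed
qed simp

section \<open>The curve generated by a bush\<close>

text \<open>The weights in \<open>split d\<close> sum to less than \<open>1\<close>; the rest of the unit interval is the gap.\<close>
locale bush =
  fixes U :: "'b::banach set" and split :: "'b \<Rightarrow> (real \<times> 'b) list" and \<epsilon> R :: real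
  assumes child: "d \<in> U \<Longrightarrow> (w, c) \<in> set (split d) \<Longrightarrow> 0 < w \<and> w \<le> 1 / 2 \<and> c \<in> U \<and> \<epsilon> \<le> norm (c - d)"
    and width_less: "d \<in> U \<Longrightarrow> width (split d) < 1"
    and mean: "d \<in> U \<Longrightarrow> (\<Sum>(w, c)\<leftarrow>split d. w *\<^sub>R c) = d"
    and norm_le: "d \<in> U \<Longrightarrow> norm d \<le> R"
begin

text \<open>Polygonal approximations of the limit curve \<open>G\<close>; the first argument counts
  the generations of the bush that are resolved.\<close>

fun H :: "nat \<Rightarrow> 'b \<Rightarrow> real \<Rightarrow> 'b" where
  "H 0 d x = max 0 (min x 1) *\<^sub>R d"
| "H (Suc k) d x = glue (H k) (split d) x"

definition G :: "'b \<Rightarrow> real \<Rightarrow> 'b" where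
  "G d x = lim (\<lambda>k. H k d x)"

lemma R_nonneg: "d \<in> U \<Longrightarrow> 0 \<le> R"
  using norm_le[of d] norm_ge_zero[of d] by linarith

lemma gluable_split:
  assumes "d \<in> U" "\<And>c. c \<in> U \<Longrightarrow> profile R c (g c)"
  shows "gluable R g (split d)"
  using assms child[OF assms(1)] by (auto simp: gluable_def)

lemma profile_glue:
  assumes "d \<in> U" "\<And>c. c \<in> U \<Longrightarrow> profile R c (g c)"
  shows "profile R d (glue g (split d))"
  using glue_left[OF gluable_split[OF assms]] glue_right[OF gluable_split[OF assms]]
    glue_lipschitz[OF gluable_split[OF assms] _ R_nonneg[OF assms(1)]]
    width_less[OF assms(1)] mean[OF assms(1)]
  by (auto simp: profile_def)

lemma profile_H: "d \<in> U \<Longrightarrow> profile R d (H k d)"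
proof (induction k arbitrary: d)
  case 0
  have "norm (H 0 d y - H 0 d x) \<le> R * (y - x)" if "x \<le> y" for x y
  proof -
    have "norm (H 0 d y - H 0 d x) = \<bar>max 0 (min y 1) - max 0 (min x 1)\<bar> * norm d"
      by (simp flip: scaleR_diff_left)
    also have "\<dots> \<le> (y - x) * R" using that norm_le[OF 0] by (intro mult_mono) auto
    finally show ?thesis by (simp add: mult.commute)
  qed
  then show ?case by (auto simp: profile_def)
next
  case (Suc k)
  have "H (Suc k) d = glue (H k) (split d)" by auto
  then show ?case using profile_glue[OF Suc.prems] Suc.IH by simp
qed

lemma profile_dist:
  assumes "d \<in> U" "profile R d g" "profile R d h"
  shows "norm (g x - h x) \<le> 2 * R"
proof -
  consider "x \<le> 0" | "1 \<le> x" | "0 \<le> x" "x \<le> 1" by linarith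
  then show ?thesis
  proof cases
    case 3
    have "norm (k x) \<le> R" if "profile R d k" for k
    proof -
      have "norm (k x - k 0) \<le> R * (x - 0)" using 3 by (intro profile_lipschitz[OF that])
      also have "\<dots> \<le> R" using 3 R_nonneg[OF assms(1)] by (simp add: mult_left_le)
      finally show ?thesis using profile_left[OF that, of 0] by simp
    qed
    from this[OF assms(2)] this[OF assms(3)] show ?thesis
      using norm_triangle_ineq4[of "g x" "h x"] by linarith
  qed (use assms R_nonneg[OF assms(1)] in \<open>auto simp: profile_left profile_right\<close>)
qed

text \<open>The base case is the crude bound \<open>profile_dist\<close>; each further generation
  gains the factor 1/2 of \<open>glue_dist\<close>.\<close>

lemma H_step: "d \<in> U \<Longrightarrow> norm (H (Suc k) d x - H k d x) \<le> 2 * R * (1 / 2) ^ k"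
proof (induction k arbitrary: d x)
  case 0
  then show ?case
    using profile_dist[OF 0 profile_H[OF 0] profile_H[OF 0], of "Suc 0" x 0] by (simp del: H.simps)
next
  case (Suc k)
  have "norm (glue (H (Suc k)) (split d) x - glue (H k) (split d) x) \<le> 2 * R * (1 / 2) ^ k / 2"
    using Suc child[OF Suc.prems] R_nonneg[OF Suc.prems]
    by (intro glue_dist[where R = R] gluable_split profile_H Suc.IH) auto
  then show ?case by simp
qed

lemma H_tendsto:
  assumes "d \<in> U"
  shows "(\<lambda>k. H k d x) \<longlonglongrightarrow> G d x"
proof -
  have "summable (\<lambda>k. 2 * R * (1 / 2) ^ k)" by (intro summable_mult summable_geometric) simp
  then have "summable (\<lambda>k. H (Suc k) d x - H k d x)"
    by (rule summable_comparison_test') (rule H_step[OF assms])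
  then have "convergent (\<lambda>n. \<Sum>k<n. H (Suc k) d x - H k d x)" by (simp add: summable_iff_convergent)
  then have "convergent (\<lambda>n. H n d x - H 0 d x)"
    by (simp only: sum_lessThan_telescope[where f = "\<lambda>n. H n d x"])
  then have "convergent (\<lambda>n. (H n d x - H 0 d x) + H 0 d x)" by (intro convergent_add convergent_const)
  then show ?thesis by (simp add: G_def convergent_LIMSEQ_iff)
qed

lemma profile_G:
  assumes "d \<in> U"
  shows "profile R d (G d)"
proof -
  note P = profile_H[OF assms] and lim = H_tendsto[OF assms]
  have "G d x = 0" if "x \<le> 0" for x
    using lim[of x] profile_left[OF P that] by (simp add: LIMSEQ_const_iff)
  moreover have "G d x = d" if "1 \<le> x" for x
    using lim[of x] profile_right[OF P that] by (simp add: LIMSEQ_const_iff)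
  moreover have "norm (G d y - G d x) \<le> R * (y - x)" if "x \<le> y" for x y
    using profile_lipschitz[OF P that]
    by (intro tendsto_upperbound[OF tendsto_norm[OF tendsto_diff[OF lim lim]]]) auto
  ultimately show ?thesis by (auto simp: profile_def)
qed

text \<open>Self-similarity of the limit: \<open>glue\<close> is a finite sum, so the recursion of
  \<open>H\<close> passes to the limit.\<close>

lemma G_eq_glue:
  assumes "d \<in> U"
  shows "G d x = glue G (split d) x"
proof -
  have "(\<lambda>k. glue (H k) L x) \<longlonglongrightarrow> glue G L x" if "\<And>w c. (w, c) \<in> set L \<Longrightarrow> c \<in> U" for L x
    using that
  proof (induction L arbitrary: x)
    case (Cons p L)
    then show ?case by (cases p) (auto intro!: tendsto_intros H_tendsto)
  qed simp
  then have "(\<lambda>k. H (Suc k) d x) \<longlonglongrightarrow> glue G (split d) x" using child[OF assms] by auto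
  moreover have "(\<lambda>k. H (Suc k) d x) \<longlonglongrightarrow> G d x" using H_tendsto[OF assms] by (rule LIMSEQ_Suc)
  ultimately show ?thesis by (rule LIMSEQ_unique[symmetric])
qed

lemma G_gap:
  assumes "d \<in> U" "width (split d) \<le> x"
  shows "G d x = d"
  using assms glue_right[OF gluable_split[OF assms(1) profile_G]] by (simp add: G_eq_glue mean)

lemma gap_or_piece:
  assumes "d \<in> U" "0 \<le> x" "x \<le> 1"
  obtains "width (split d) \<le> x"
  | a w c where "c \<in> U" "0 < w" "w \<le> 1 / 2" "\<epsilon> \<le> norm (c - d)" "0 \<le> a" "a + w \<le> 1" "a \<le> x" "x \<le> a + w"
    "\<And>y. 0 \<le> y \<Longrightarrow> y \<le> 1 \<Longrightarrow> G d (a + w * y) = G d a + w *\<^sub>R G c y"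
proof (cases "width (split d) \<le> x")
  case False
  note glu = gluable_split[OF assms(1) profile_G]
  obtain L w c M where L: "split d = L @ (w, c) # M" "width L \<le> x" "x \<le> width L + w"
    using piece_containing[OF glu assms(2)] False by force
  have "gluable R G L" "gluable R G M" using glu by (auto simp: L)
  then have "0 \<le> width L" "0 \<le> width M" by (auto intro: width_nonneg)
  moreover have "width L + w + width M < 1" using width_less[OF assms(1)] by (simp add: L)
  moreover have "G d (width L + w * y) = G d (width L) + w *\<^sub>R G c y" if "0 \<le> y" "y \<le> 1" for y
    using glue_piece[of R G L w c M y] glu that assms(1) by (simp add: G_eq_glue L)
  ultimately show ?thesis using that(2)[of c w "width L"] child[OF assms(1), of w c] L by auto
qed (use that in auto)

text \<open>Descends by \<open>gap_or_piece\<close> into ever smaller pieces around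
  \<open>x\<close>. Either a gap is met on the way, giving a nondegenerate interval around
  \<open>x\<close> on which the curve is constant, or after enough halvings the piece is shorter
  than \<open>r\<close>.\<close>

lemma zoom:
  assumes "d \<in> U" "0 \<le> x" "x \<le> 1" "0 < r"
  obtains p q where "0 \<le> p" "p \<le> x" "x \<le> q" "q \<le> 1" "p < q" "\<And>y. p \<le> y \<Longrightarrow> y \<le> q \<Longrightarrow> G d y = G d x"
  | a w c where "c \<in> U" "0 < w" "w < r" "0 \<le> a" "a + w \<le> 1" "a \<le> x" "x \<le> a + w"
    "\<And>y. 0 \<le> y \<Longrightarrow> y \<le> 1 \<Longrightarrow> G d (a + w * y) = G d a + w *\<^sub>R G c y"
proof -
  have "(\<exists>p q. 0 \<le> p \<and> p \<le> x \<and> x \<le> q \<and> q \<le> 1 \<and> p < q \<and> (\<forall>y. p \<le> y \<longrightarrow> y \<le> q \<longrightarrow> G d y = G d x)) \<or>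
    (\<exists>a w c. c \<in> U \<and> 0 < w \<and> w < r \<and> 0 \<le> a \<and> a + w \<le> 1 \<and> a \<le> x \<and> x \<le> a + w \<and>
      (\<forall>y. 0 \<le> y \<longrightarrow> y \<le> 1 \<longrightarrow> G d (a + w * y) = G d a + w *\<^sub>R G c y))"
    (is "?const d x \<or> ?cell d x r")
    if "1 < r * 2 ^ n" "d \<in> U" "0 \<le> x" "x \<le> 1" "0 < r" for n d x r
    using that
  proof (induction n arbitrary: d x r)
    case 0
    have "?cell d x r"
      using 0 profile_left[OF profile_G[OF 0(2)], of 0] by (intro exI[of _ 0] exI[of _ 1] exI[of _ d]) auto
    then show ?case ..
  next
    case (Suc n)
    from Suc.prems(2-4) show ?case
    proof (cases rule: gap_or_piece)
      case 1
      have "?const d x"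
        using 1 Suc.prems width_less[OF Suc.prems(2)]
          width_nonneg[OF gluable_split[OF Suc.prems(2) profile_G]]
        by (intro exI[of _ "width (split d)"] exI[of _ 1]) (auto simp: G_gap)
      then show ?thesis ..
    next
      case (2 a w c)
      define x' where "x' = (x - a) / w"
      have x: "x = a + w * x'" and x': "0 \<le> x'" "x' \<le> 1"
        using 2 by (auto simp: x'_def field_simps)
      \<comment> \<open>Blowing the piece up to unit length at least doubles the allowed width,
        which pays for one factor 2 in \<open>2 ^ Suc n\<close>.\<close>
      have "r * 2 \<le> r / w" using 2(2,3) Suc.prems(5) by (simp add: field_simps)
      then have "r * 2 * 2 ^ n \<le> r / w * 2 ^ n" by (intro mult_right_mono) auto
      then have "1 < r / w * 2 ^ n" using Suc.prems(1) by (simp add: mult.assoc)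
      moreover have "0 < r / w" using 2(2) Suc.prems(5) by simp
      ultimately have "?const c x' \<or> ?cell c x' (r / w)"
        using Suc.IH[of "r / w" c x'] 2(1) x' by blast
      then show ?thesis
      proof
        assume "?const c x'"
        then obtain p q where pq: "0 \<le> p" "p \<le> x'" "x' \<le> q" "q \<le> 1" "p < q"
          "\<And>y. p \<le> y \<Longrightarrow> y \<le> q \<Longrightarrow> G c y = G c x'" by blast
        have "G d y = G d x" if "a + w * p \<le> y" "y \<le> a + w * q" for y
        proof -
          define y' where "y' = (y - a) / w"
          have y: "y = a + w * y'" "p \<le> y'" "y' \<le> q"
            using that 2(2) by (auto simp: y'_def field_simps)
          then show ?thesis using 2(9)[of y'] 2(9)[of x'] pq(6)[of y'] pq(1-5) x' by (simp add: x)
        qed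
        moreover have "0 \<le> a + w * p" "a + w * p \<le> x" "x \<le> a + w * q" "a + w * p < a + w * q"
          using pq(1-5) 2(2,5) by (auto simp: x)
        moreover have "a + w * q \<le> 1" using pq 2(2,6) mult_left_le[of q w] by linarith
        ultimately have "?const d x" by blast
        then show ?thesis ..
      next
        assume "?cell c x' (r / w)"
        then obtain a' w' c' where c': "c' \<in> U" "0 < w'" "w' < r / w" "0 \<le> a'" "a' + w' \<le> 1" "a' \<le> x'" "x' \<le> a' + w'"
          "\<And>y. 0 \<le> y \<Longrightarrow> y \<le> 1 \<Longrightarrow> G c (a' + w' * y) = G c a' + w' *\<^sub>R G c' y" by blast
        have "G d (a + w * a' + w * w' * y) = G d (a + w * a') + (w * w') *\<^sub>R G c' y" if "0 \<le> y" "y \<le> 1" for y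
        proof -
          have "w' * y \<le> w'" "0 \<le> w' * y" using c' that by (auto simp: mult_left_le)
          then have "G d (a + w * (a' + w' * y)) = G d a + w *\<^sub>R G c (a' + w' * y)"
            using c' by (intro 2(9)) linarith+
          moreover have "G d (a + w * a') = G d a + w *\<^sub>R G c a'"
            using c' by (intro 2(9)) linarith+
          ultimately show ?thesis using c'(8)[OF that] by (simp add: algebra_simps)
        qed
        moreover have "0 < w * w'" "w * w' < r" "0 \<le> a + w * a'" "a + w * a' \<le> x"
          using c'(2-7) 2(2,5) by (auto simp: x field_simps)
        moreover have "x \<le> a + w * a' + w * w'"
          using mult_left_mono[OF c'(7), of w] 2(2) by (simp add: x algebra_simps)
        moreover have "a + w * a' + w * w' \<le> 1"
          using mult_left_mono[OF c'(5), of w] 2(2,6) by (simp add: algebra_simps)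
        ultimately have "?cell d x r" using c'(1) by blast
        then show ?thesis ..
      qed
    qed
  qed
  moreover obtain n where "1 / r < 2 ^ n" using real_arch_pow[of 2 "1 / r"] by auto
  then have "1 < r * 2 ^ n" using assms by (simp add: field_simps)
  ultimately show ?thesis using assms that by blast
qed

text \<open>The curve is constant on either side of [0, 1]. Otherwise zooming at the midpoint of
  [s, t] finds a constant stretch around it or a cell inside (s, t), and the cell contains a scaled
  copy of the gap of \<open>c\<close>.\<close>

lemma G_not_injective:
  assumes "d \<in> U" "s < t"
  obtains p q where "s < p" "p < q" "q < t" "G d p = G d q"
proof -
  note P = profile_G[OF assms(1)]
  define x r where "x = (s + t) / 2" and "r = (t - s) / 2"
  have r: "r > 0" and st: "s = x - r" "t = x + r" using assms by (auto simp: x_def r_def field_simps)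
  consider "x < 0" | "1 < x" | "0 \<le> x" "x \<le> 1" by linarith
  then show thesis
  proof cases
    case 1
    then show thesis
      using that[of "x - r / 2" x] r profile_left[OF P, of x] profile_left[OF P, of "x - r / 2"]
      by (auto simp: st)
  next
    case 2
    then show thesis
      using that[of x "x + r / 2"] r profile_right[OF P, of x] profile_right[OF P, of "x + r / 2"]
      by (auto simp: st)
  next
    case 3
    from assms(1) 3 r show thesis
    proof (cases rule: zoom)
      case (1 p q)
      show thesis
        using that[of "max p (x - r / 2)" "min q (x + r / 2)"] 1(1-5) r 1(6)[of "max p (x - r / 2)"]
           1(6)[of "min q (x + r / 2)"]
        by (auto simp: st)
    next
      case (2 a w c)
      define v where "v = width (split c)"
      have v: "0 \<le> v" "v < 1"
        using width_less[OF 2(1)] width_nonneg[OF gluable_split[OF 2(1) profile_G]] by (auto simp: v_def)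
      have "G d (a + w * v) = G d (a + w)"
        using v 2(8)[of v] 2(8)[of 1]
        by (simp add: G_gap[OF 2(1)] v_def profile_right[OF profile_G[OF 2(1)]])
      moreover have "0 \<le> w * v" "w * v < w" using v 2(2) by auto
      ultimately show thesis using that[of "a + w * v" "a + w"] 2(2-7) r by (auto simp: st)
    qed
  qed
qed

text \<open>An approximate derivative \<open>l\<close> would be close to the mean slopes \<open>d\<close> and \<open>c\<close> of two nested
  small pieces, although \<open>\<parallel>c - d\<parallel> \<ge> \<epsilon>\<close>.\<close>
lemma G_no_derivative:
  assumes "d \<in> U" "2 * \<delta> < \<epsilon>" "\<delta> < norm l" "0 < r"
    and deriv: "\<And>y. \<bar>y - x\<bar> < r \<Longrightarrow> norm (G d y - G d x - (y - x) *\<^sub>R l) \<le> \<delta> * \<bar>y - x\<bar>"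
  shows False
proof -
  note P = profile_G[OF assms(1)]
  \<comment> \<open>The linear term beats the error because \<open>\<delta> < norm l\<close>, so
    near \<open>x\<close> the curve does not return to its value at \<open>x\<close>. This excludes
    points outside [0, 1] and stretches where the curve is constant.\<close>
  have noteq: "G d y \<noteq> G d x" if "y \<noteq> x" "\<bar>y - x\<bar> < r" for y
  proof
    assume "G d y = G d x"
    then have "\<bar>y - x\<bar> * norm l \<le> \<bar>y - x\<bar> * \<delta>" using deriv[OF that(2)] by (simp add: mult.commute)
    then show False using that assms(3) by (simp add: mult_le_cancel_left)
  qed
  \<comment> \<open>Subtract the estimates at the two ends of the piece: \<open>x\<close> lies
    between them, so the errors add up to exactly \<open>w * \<delta>\<close>.\<close>
  have slope: "norm (e - l) \<le> \<delta>" if "G d (a + w) - G d a = w *\<^sub>R e" "0 < w" "w < r" "a \<le> x" "x \<le> a + w" for e a w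
  proof -
    have "norm (G d (a + w) - G d x - (a + w - x) *\<^sub>R l) \<le> \<delta> * \<bar>a + w - x\<bar>"
      "norm (G d a - G d x - (a - x) *\<^sub>R l) \<le> \<delta> * \<bar>a - x\<bar>"
      using that by (intro deriv; linarith)+
    then have "norm ((G d (a + w) - G d x - (a + w - x) *\<^sub>R l) - (G d a - G d x - (a - x) *\<^sub>R l))
        \<le> \<delta> * \<bar>a + w - x\<bar> + \<delta> * \<bar>a - x\<bar>"
      by (meson norm_triangle_ineq4 add_mono order_trans)
    also have "(G d (a + w) - G d x - (a + w - x) *\<^sub>R l) - (G d a - G d x - (a - x) *\<^sub>R l)
        = (G d (a + w) - G d a) - w *\<^sub>R l"
      by (simp add: algebra_simps)
    also have "\<dots> = w *\<^sub>R (e - l)" unfolding that(1) by (simp add: algebra_simps)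
    also have "\<delta> * \<bar>a + w - x\<bar> + \<delta> * \<bar>a - x\<bar> = w * \<delta>"
      using that by (simp add: algebra_simps)
    finally show ?thesis using that(2) by simp
  qed
  consider "x < 0" | "1 < x" | "0 \<le> x" "x \<le> 1" by linarith
  then show False
  proof cases
    case 1
    then show False using noteq[of "x - r / 2"] assms(4) by (auto simp: profile_left[OF P])
  next
    case 2
    then show False using noteq[of "x + r / 2"] assms(4) by (auto simp: profile_right[OF P])
  next
    case 3
    from assms(1) 3 assms(4) show False
    proof (cases rule: zoom)
      case (1 p q)
      define y where "y = (if x < q then min q (x + r / 2) else max p (x - r / 2))"
      have "y \<noteq> x" "\<bar>y - x\<bar> < r" "p \<le> y" "y \<le> q" using 1(1-5) assms(4) by (auto simp: y_def)
      then show False using noteq 1(6) by blast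
    next
      case (2 a w c)
      have c: "norm (c - l) \<le> \<delta>"
        using slope[of a w c] 2 2(8)[of 1] by (simp add: profile_right[OF profile_G])
      define x' where "x' = (x - a) / w"
      have x: "x = a + w * x'" and x': "0 \<le> x'" "x' \<le> 1"
        using 2 by (auto simp: x'_def field_simps)
      from 2(1) x' show False
      proof (cases rule: gap_or_piece)
        case 1
        define v where "v = width (split c)"
        have v: "0 \<le> v" "v < 1"
          using width_less[OF 2(1)] width_nonneg[OF gluable_split[OF 2(1) profile_G]] by (auto simp: v_def)
        \<comment> \<open>A second point of the gap [v, 1], different from
          \<open>x'\<close>.\<close>
        define y where "y = (if x' = 1 then v else 1)"
        have y: "v \<le> y" "0 \<le> y" "y \<le> 1" "y \<noteq> x'" using v by (auto simp: y_def)
        then have "G d (a + w * y) = G d x"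
          using 1 2 x' by (simp add: x G_gap v_def)
        moreover have "\<bar>a + w * y - x\<bar> < r"
        proof -
          have "\<bar>w * (y - x')\<bar> \<le> w * 1"
            unfolding abs_mult using y x' 2(2) by (intro mult_mono) auto
          then show ?thesis using 2(3) by (simp add: x right_diff_distrib)
        qed
        ultimately show False using noteq[of "a + w * y"] y 2(2) by (simp add: x)
      next
        case (2 a' w' c')
        note inner = this and outer = \<open>0 < w\<close> \<open>w < r\<close>
          \<open>\<And>y. 0 \<le> y \<Longrightarrow> y \<le> 1 \<Longrightarrow> G d (a + w * y) = G d a + w *\<^sub>R G c y\<close>
        \<comment> \<open>Seen from \<open>d\<close>, the inner piece has length
          \<open>w * w'\<close> and mean slope \<open>c'\<close>.\<close>
        have "G d (a + w * (a' + w')) - G d (a + w * a') = w *\<^sub>R (G c (a' + w' * 1) - G c a')"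
          using inner by (subst (1 2) outer(3)) (auto simp: algebra_simps)
        also have "\<dots> = (w * w') *\<^sub>R c'"
          using inner(1) by (subst inner(9)) (auto simp: profile_right[OF profile_G])
        finally have "G d (a + w * a' + w * w') - G d (a + w * a') = (w * w') *\<^sub>R c'"
          by (simp add: algebra_simps)
        moreover have "w * w' < r"
          using mult_left_le[of w' w] inner(3) outer(1,2) by linarith
        ultimately have "norm (c' - l) \<le> \<delta>"
          using slope[of "a + w * a'" "w * w'" c'] inner outer by (simp add: x flip: distrib_left add.assoc)
        then have "norm (c' - c) \<le> \<delta> + \<delta>"
          using c norm_triangle_ineq4[of "c' - l" "c - l"] by simp
        then show False using inner(4) assms(2) by simp
      qed
    qed
  qed
qed

end

section \<open>From a set that is not dentable to a bush\<close>

text \<open>Each \<open>d\<close> in \<open>U\<close> is near some \<open>y\<close> in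
  \<open>D\<close>, and \<open>y\<close> is almost a convex combination of points of
  \<open>D\<close> far from \<open>y\<close>. Translating these points by a small vector keeps them
  in \<open>U\<close> and makes the combination equal to \<open>s\<close> times \<open>d\<close>,
  for some \<open>s > 1\<close>; dividing the weights by \<open>s\<close> gives \<open>d\<close>
  with total weight below 1.\<close>

lemma not_dentable_imp_bush:
  fixes D :: "'b::banach set"
  assumes "bounded D" "D \<noteq> {}" "\<not> dentable D"
  obtains U split \<epsilon> R where "bush (U :: 'b set) split \<epsilon> R" "0 < \<epsilon>" "0 < R"
    "\<And>\<eta>. 0 < \<eta> \<Longrightarrow> \<exists>d\<in>U. R - \<eta> < norm d"
proof -
  obtain e where e: "e > 0" "\<And>y. y \<in> D \<Longrightarrow> y \<in> closure (convex hull (D - ball y e))"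
    using assms by (auto simp: dentable_def)
  \<comment> \<open>The points used are at least 4r away from \<open>y\<close>; translating them and
    passing from \<open>y\<close> to \<open>d\<close> each cost less than \<open>r\<close>, which
    leaves 2r.\<close>
  define r where "r = e / 4"
  define U where "U = (\<Union>y\<in>D. ball y r)"
  have r: "r > 0" "e = 4 * r" using e by (auto simp: r_def)
  define good where "good d L \<longleftrightarrow> (\<forall>(w, c)\<in>set L. 0 < w \<and> w \<le> 1 / 2 \<and> c \<in> U \<and> 2 * r \<le> norm (c - d)) \<and>
      width L < 1 \<and> (\<Sum>(w, c)\<leftarrow>L. w *\<^sub>R c) = d" for d L
  have split: "\<exists>L. good d L" if d: "d \<in> U" for d
  proof -
    obtain y where y: "y \<in> D" "dist y d < r" using d by (auto simp: U_def)
    obtain s where s: "1 < s" "dist y (s *\<^sub>R d) < r"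
    proof -
      have "((\<lambda>s. dist y (s *\<^sub>R d)) \<longlongrightarrow> dist y (1 *\<^sub>R d)) (at_right 1)"
        by (intro tendsto_intros)
      then have "\<forall>\<^sub>F s in at_right 1. dist y (s *\<^sub>R d) < r"
        using y(2) by (intro order_tendstoD(2)) auto
      then have "\<forall>\<^sub>F s in at_right (1::real). 1 < s \<and> dist y (s *\<^sub>R d) < r"
        by (intro eventually_conj eventually_at_right_less)
      then show ?thesis using that eventually_happens'[OF trivial_limit_at_right_real] by blast
    qed
    obtain p where p: "p \<in> convex hull (D - ball y e)" "dist p y < r - dist y (s *\<^sub>R d)"
      using e(2)[OF y(1)] s(2) unfolding closure_approachable by (metis diff_gt_0_iff_gt)
    have sp: "norm (s *\<^sub>R d - p) < r"
      using p(2) dist_triangle[of "s *\<^sub>R d" p y] by (simp add: dist_norm norm_minus_commute)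
    obtain S u where S: "finite S" "S \<subseteq> D - ball y e" "\<And>x. x \<in> S \<Longrightarrow> 0 \<le> u x" "sum u S = 1"
      "(\<Sum>x\<in>S. u x *\<^sub>R x) = p"
      using p(1) by (auto simp: convex_hull_explicit)
    \<comment> \<open>Points of weight 0 would give pieces of width 0.\<close>
    define S' where "S' = {x \<in> S. u x \<noteq> 0}"
    have "sum u S' = sum u S" "(\<Sum>x\<in>S'. u x *\<^sub>R x) = (\<Sum>x\<in>S. u x *\<^sub>R x)"
      using S(1) by (intro sum.mono_neutral_left; auto simp: S'_def)+
    then have S': "finite S'" "S' \<subseteq> D - ball y e" "\<And>x. x \<in> S' \<Longrightarrow> 0 < u x" "sum u S' = 1"
      "(\<Sum>x\<in>S'. u x *\<^sub>R x) = p"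
      using S by (auto simp: S'_def less_le)
    obtain xs where xs: "set xs = S'" "distinct xs" using finite_distinct_list[OF S'(1)] by blast
    \<comment> \<open>\<open>M\<close> carries half of the mass, so that every weight in
      \<open>M @ M\<close> is at most 1/2.\<close>
    define M where "M = map (\<lambda>x. (u x / (2 * s), x + (s *\<^sub>R d - p))) xs"
    have "u x \<le> 1" if "x \<in> S'" for x
      using member_le_sum[OF that, of u] S' by (auto simp: less_imp_le)
    then have "0 < u x / (2 * s) \<and> u x / (2 * s) \<le> 1 / 2" if "x \<in> S'" for x
      using s(1) S'(3)[OF that] that by (fastforce simp: field_simps)
    moreover have "x + (s *\<^sub>R d - p) \<in> U" if "x \<in> S'" for x
      using that sp S'(2) unfolding U_def
      by (intro UN_I[of x]) (auto simp: dist_norm norm_minus_commute)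
    moreover have "2 * r \<le> norm (x + (s *\<^sub>R d - p) - d)" if "x \<in> S'" for x
    proof -
      have "4 * r \<le> norm (x - y)" using that S'(2) r by (auto simp: dist_norm norm_minus_commute)
      also have "x - y = (x + (s *\<^sub>R d - p) - d) - (s *\<^sub>R d - p) - (y - d)" by simp
      also have "norm \<dots> \<le> norm (x + (s *\<^sub>R d - p) - d) + norm (s *\<^sub>R d - p) + norm (y - d)"
        by (rule order_trans[OF norm_triangle_ineq4 add_right_mono[OF norm_triangle_ineq4]])
      finally show ?thesis using sp y(2) by (simp add: dist_norm)
    qed
    ultimately have "\<forall>(w, c)\<in>set (M @ M). 0 < w \<and> w \<le> 1 / 2 \<and> c \<in> U \<and> 2 * r \<le> norm (c - d)"
      by (auto simp: M_def xs)
    moreover have "width M = 1 / (2 * s)"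
      using S'(4) by (simp add: width_def M_def comp_def sum_list_distinct_conv_sum_set xs flip: sum_divide_distrib)
    then have "width (M @ M) < 1" using s(1) by simp
    moreover have "(\<Sum>(w, c)\<leftarrow>M. w *\<^sub>R c) = (1 / 2) *\<^sub>R d"
    proof -
      have "(\<Sum>(w, c)\<leftarrow>M. w *\<^sub>R c) = (\<Sum>x\<in>S'. (u x / (2 * s)) *\<^sub>R (x + (s *\<^sub>R d - p)))"
        by (simp add: M_def comp_def sum_list_distinct_conv_sum_set xs)
      also have "\<dots> = (1 / (2 * s)) *\<^sub>R ((\<Sum>x\<in>S'. u x *\<^sub>R x) + sum u S' *\<^sub>R (s *\<^sub>R d - p))"
        by (simp add: scaleR_right.sum scaleR_left.sum scaleR_add_right sum.distrib del: scaleR_diff_right)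
      also have "\<dots> = (1 / 2) *\<^sub>R d" using s(1) S'(4,5) by simp
      finally show ?thesis .
    qed
    then have "(\<Sum>(w, c)\<leftarrow>M @ M. w *\<^sub>R c) = d" by (simp flip: scaleR_add_left)
    ultimately show ?thesis unfolding good_def by blast
  qed
  obtain B where B: "\<And>y. y \<in> D \<Longrightarrow> norm y \<le> B" using assms(1) by (auto simp: bounded_iff)
  have "norm d \<le> B + r" if d: "d \<in> U" for d
  proof -
    obtain y where "y \<in> D" "dist y d < r" using d by (auto simp: U_def)
    then show ?thesis using B norm_triangle_sub[of d y] by (fastforce simp: dist_norm norm_minus_commute)
  qed
  then have bdd: "bdd_above (norm ` U)" by (intro bdd_aboveI2[where M = "B + r"])
  define R where "R = (SUP d\<in>U. norm d)"
  have DU: "D \<subseteq> U" using r by (auto simp: U_def)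
  then have U: "U \<noteq> {}" using assms(2) by auto
  have R: "norm d \<le> R" if "d \<in> U" for d
    unfolding R_def by (rule cSUP_upper[OF that bdd])
  obtain split where split_good: "\<And>d. d \<in> U \<Longrightarrow> good d (split d)"
    using split by metis
  have "bush U split (2 * r) R"
  proof
    fix d w c
    assume "d \<in> U" "(w, c) \<in> set (split d)"
    then show "0 < w \<and> w \<le> 1 / 2 \<and> c \<in> U \<and> 2 * r \<le> norm (c - d)"
      using split_good unfolding good_def by blast
  qed (use R split_good in \<open>auto simp: good_def\<close>)
  \<comment> \<open>\<open>D\<close> has two distinct points, and one of them is nonzero.\<close>
  moreover have "0 < R"
  proof -
    obtain y where y: "y \<in> D" using assms(2) by blast
    then have "D - ball y e \<noteq> {}" using e(2) by (metis closure_empty convex_hull_empty empty_iff)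
    then obtain y' where "y' \<in> D" "y' \<notin> ball y e" by blast
    moreover from this have "y' \<noteq> y" using e(1) by auto
    ultimately have "\<exists>d\<in>U. 0 < norm d" using y DU by (cases "y = 0") auto
    then show ?thesis using R by (meson less_le_trans)
  qed
  moreover have "\<exists>d\<in>U. R - \<eta> < norm d" if "0 < \<eta>" for \<eta>
    using that less_cSUP_iff[OF U bdd, of "R - \<eta>"] by (simp add: R_def)
  ultimately show thesis using that[of U split "2 * r" R] r(1) by simp
qed

section \<open>Lipschitz norms and norm attainment\<close>

lemma lip_norm_upper:
  assumes "L-lipschitz_on UNIV f" "p \<noteq> q"
  shows "norm (f p - f q) \<le> lip_norm f * norm (p - q)"
proof -
  have "norm (f p - f q) / norm (p - q) \<le> L" if "p \<noteq> q" for p q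
    using lipschitz_on_normD[OF assms(1), of p q] that by (simp add: divide_le_eq)
  then have "bdd_above {norm (f p - f q) / norm (p - q) | p q. p \<noteq> q}" by (auto intro!: bdd_aboveI)
  then have "norm (f p - f q) / norm (p - q) \<le> lip_norm f"
    unfolding lip_norm_def using assms(2) by (intro cSup_upper) auto
  then show ?thesis using assms(2) by (simp add: divide_le_eq)
qed

text \<open>From \<open>p\<close> to \<open>q\<close> the two outer legs gain at most
  \<open>K\<close> times their length, so equality over the whole segment leaves the full gain to
  the middle leg.\<close>

lemma strongly_attaining_segment:
  fixes g :: "'a::real_normed_vector \<Rightarrow> 'b::real_normed_vector"
  assumes lip: "\<And>x y. norm (g x - g y) \<le> K * norm (x - y)"
    and "norm (g p - g q) = K * norm (p - q)" "0 \<le> s" "s \<le> t" "t \<le> 1"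
  defines "c \<equiv> \<lambda>t. p + t *\<^sub>R (q - p)"
  shows "K * (t - s) * norm (p - q) \<le> norm (g (c t) - g (c s))"
proof -
  have "norm (p - c s) = s * norm (p - q)" "norm (c t - q) = (1 - t) * norm (p - q)"
  proof -
    have "p - c s = s *\<^sub>R (p - q)" "c t - q = (1 - t) *\<^sub>R (p - q)" by (simp_all add: c_def algebra_simps)
    then show "norm (p - c s) = s * norm (p - q)" "norm (c t - q) = (1 - t) * norm (p - q)"
      using assms by simp_all
  qed
  then have "norm (g p - g (c s)) \<le> K * (s * norm (p - q))" "norm (g (c t) - g q) \<le> K * ((1 - t) * norm (p - q))"
    using lip by metis+
  moreover have "norm (g p - g q) \<le> norm (g p - g (c s)) + norm (g (c t) - g (c s)) + norm (g (c t) - g q)"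
  proof -
    have "g p - g q = (g p - g (c s)) - (g (c t) - g (c s)) + (g (c t) - g q)" by simp
    then show ?thesis
      using norm_triangle_ineq[of "(g p - g (c s)) - (g (c t) - g (c s))" "g (c t) - g q"]
        norm_triangle_ineq4[of "g p - g (c s)" "g (c t) - g (c s)"] by simp
  qed
  ultimately show ?thesis using assms(2) by (simp add: algebra_simps)
qed

lemma lip_norm_least:
  assumes "\<exists>x::'a::real_normed_vector. x \<noteq> 0" "\<And>p q. norm (f p - f q) \<le> K * norm (p - q :: 'a)"
  shows "lip_norm f \<le> K"
  unfolding lip_norm_def
proof (rule cSup_least)
  obtain x :: 'a where "x \<noteq> 0" using assms(1) by blast
  then show "{norm (f p - f q) / norm (p - q) |p q. p \<noteq> q} \<noteq> {}" by blast
qed (use assms(2) in \<open>auto simp: divide_le_eq\<close>)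

section \<open>Removing an inner 1-Lipschitz function from a derivative\<close>

text \<open>Replacing \<open>u\<close> by \<open>u \<circ> uminus\<close> and \<open>l\<close> by \<open>-l\<close>, one may assume that \<open>u\<close> increases through \<open>u 0\<close>;
  it then grows almost at unit speed, because \<open>\<parallel>l\<parallel>\<close> is almost \<open>R\<close>.\<close>
lemma inner_derivative_increasing:
  fixes F :: "real \<Rightarrow> 'b::real_normed_vector" and u :: "real \<Rightarrow> real"
  assumes F: "\<And>a b. norm (F a - F b) \<le> R * \<bar>a - b\<bar>"
    and u: "\<And>a b. \<bar>u a - u b\<bar> \<le> \<bar>a - b\<bar>"
    and deriv: "\<And>t. \<bar>t\<bar> < r \<Longrightarrow> norm (F (u t) - F (u 0) - t *\<^sub>R l) \<le> 2 * \<theta> * \<bar>t\<bar>"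
    and l: "R - 2 * \<theta> \<le> norm l" "norm l \<le> R + \<theta>"
    and \<theta>: "0 < \<theta>" "200 * \<theta> \<le> R" and r: "0 < r"
    and incr: "u (- (r / 2)) < u 0" "u 0 < u (r / 2)"
    and v: "\<bar>v - u 0\<bar> < r / 4"
  shows "norm (F v - F (u 0) - (v - u 0) *\<^sub>R l) \<le> 20 * \<theta> * \<bar>v - u 0\<bar>"
proof -
  \<comment> \<open>\<open>F\<close> moves by at most \<open>R\<close> per unit, whereas following
    \<open>l\<close> takes almost \<open>R\<close> per unit of \<open>t\<close>; hence
    \<open>u\<close> moves at almost unit speed.\<close>
  have speed: "(R - 4 * \<theta>) * \<bar>t\<bar> \<le> R * \<bar>u t - u 0\<bar>" if "\<bar>t\<bar> < r" for t
  proof -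
    have "(R - 2 * \<theta>) * \<bar>t\<bar> \<le> norm (t *\<^sub>R l)" using l(1) by (simp add: mult.commute mult_left_mono)
    also have "\<dots> \<le> norm (F (u t) - F (u 0)) + norm (F (u t) - F (u 0) - t *\<^sub>R l)"
      using norm_triangle_ineq4[of "F (u t) - F (u 0)" "F (u t) - F (u 0) - t *\<^sub>R l"] by simp
    also have "\<dots> \<le> R * \<bar>u t - u 0\<bar> + 2 * \<theta> * \<bar>t\<bar>" by (intro add_mono F deriv that)
    finally show ?thesis by (simp add: algebra_simps)
  qed
  have speed2: "\<bar>t\<bar> \<le> 2 * \<bar>u t - u 0\<bar>" if "\<bar>t\<bar> < r" for t
  proof -
    have "R / 2 * \<bar>t\<bar> \<le> (R - 4 * \<theta>) * \<bar>t\<bar>" using \<theta> by (intro mult_right_mono) auto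
    then have "R * \<bar>t\<bar> \<le> R * (2 * \<bar>u t - u 0\<bar>)" using speed[OF that] by simp
    then show ?thesis using \<theta> by (simp add: mult_le_cancel_left)
  qed
  have cont: "continuous_on A u" for A
    using u by (intro continuous_on_subset[OF lipschitz_on_continuous_on[of 1 UNIV u]])
      (auto simp: lipschitz_on_def dist_real_def)
  \<comment> \<open>By \<open>speed2\<close>, \<open>u\<close> moves at least r/4 to each side, so
    the intermediate value theorem hits \<open>v\<close> at a \<open>t\<close> with the sign of
    \<open>v - u 0\<close>.\<close>
  obtain t where t: "u t = v" "\<bar>t\<bar> \<le> r / 2" "0 \<le> t \<longleftrightarrow> u 0 \<le> v"
  proof (cases "u 0 \<le> v")
    case True
    have "r / 4 \<le> u (r / 2) - u 0" using speed2[of "r / 2"] r incr by simp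
    then have "v \<le> u (r / 2)" using v by linarith
    then obtain t where "0 \<le> t" "t \<le> r / 2" "u t = v"
      using IVT'[of u 0 v "r / 2"] True cont r by auto
    then show ?thesis using that[of t] True by simp
  next
    case False
    have "r / 4 \<le> u 0 - u (- (r / 2))" using speed2[of "- (r / 2)"] r incr by simp
    then have "u (- (r / 2)) \<le> v" using v by linarith
    then obtain t where "- (r / 2) \<le> t" "t \<le> 0" "u t = v"
      using IVT'[of u "- (r / 2)" v 0] False cont r by auto
    moreover from this have "t \<noteq> 0" using False by auto
    ultimately show ?thesis using that[of t] False by simp
  qed
  have tr: "\<bar>t\<bar> < r" using t(2) r by simp
  \<comment> \<open>Equal signs turn the distance into a difference of absolute values, to which
    \<open>speed\<close> applies.\<close>
  have "\<bar>t - (v - u 0)\<bar> = \<bar>t\<bar> - \<bar>v - u 0\<bar>"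
    using t(3) u[of t 0] by (auto simp: t(1) abs_if split: if_splits)
  then have "R * \<bar>t - (v - u 0)\<bar> = R * \<bar>t\<bar> - R * \<bar>v - u 0\<bar>" by (simp only: right_diff_distrib)
  then have "R * \<bar>t - (v - u 0)\<bar> \<le> 4 * \<theta> * \<bar>t\<bar>"
    using speed[OF tr] by (simp add: t(1) left_diff_distrib)
  moreover have "\<bar>t - (v - u 0)\<bar> * norm l \<le> \<bar>t - (v - u 0)\<bar> * (2 * R)"
    using l \<theta> by (intro mult_left_mono) auto
  moreover have "\<bar>t - (v - u 0)\<bar> * (2 * R) = 2 * (R * \<bar>t - (v - u 0)\<bar>)" by simp
  ultimately have "norm ((t - (v - u 0)) *\<^sub>R l) \<le> 8 * \<theta> * \<bar>t\<bar>"
    unfolding norm_scaleR by linarith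
  moreover have "norm (F v - F (u 0) - t *\<^sub>R l) \<le> 2 * \<theta> * \<bar>t\<bar>" using deriv[OF tr] by (simp add: t(1))
  moreover have eq: "F v - F (u 0) - (v - u 0) *\<^sub>R l = (F v - F (u 0) - t *\<^sub>R l) + (t - (v - u 0)) *\<^sub>R l"
    by (simp add: algebra_simps)
  ultimately have "norm (F v - F (u 0) - (v - u 0) *\<^sub>R l) \<le> 10 * \<theta> * \<bar>t\<bar>"
    using norm_triangle_ineq[of "F v - F (u 0) - t *\<^sub>R l" "(t - (v - u 0)) *\<^sub>R l"]
    unfolding eq by linarith
  also have "\<dots> \<le> 10 * \<theta> * (2 * \<bar>v - u 0\<bar>)"
    using speed2[OF tr] \<theta> by (intro mult_left_mono) (auto simp: t(1))
  finally show ?thesis by simp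
qed

lemma inner_derivative:
  fixes F :: "real \<Rightarrow> 'b::real_normed_vector" and u :: "real \<Rightarrow> real"
  assumes F: "\<And>a b. norm (F a - F b) \<le> R * \<bar>a - b\<bar>"
    and u: "\<And>a b. \<bar>u a - u b\<bar> \<le> \<bar>a - b\<bar>"
    and deriv: "\<And>t. \<bar>t\<bar> < r \<Longrightarrow> norm (F (u t) - F (u 0) - t *\<^sub>R l) \<le> 2 * \<theta> * \<bar>t\<bar>"
    and l: "R - 2 * \<theta> \<le> norm l" "norm l \<le> R + \<theta>"
    and \<theta>: "0 < \<theta>" "200 * \<theta> \<le> R" and r: "0 < r"
  obtains l' where "norm l' = norm l"
    "\<And>v. \<bar>v - u 0\<bar> < r / 4 \<Longrightarrow> norm (F v - F (u 0) - (v - u 0) *\<^sub>R l') \<le> 20 * \<theta> * \<bar>v - u 0\<bar>"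
proof -
  define a b where "a = u (r / 2)" and "b = u (- (r / 2))"
  have da: "norm (F a - F (u 0) - (r / 2) *\<^sub>R l) \<le> \<theta> * r"
    and db: "norm (F b - F (u 0) + (r / 2) *\<^sub>R l) \<le> \<theta> * r"
    using deriv[of "r / 2"] deriv[of "- (r / 2)"] r by (auto simp: a_def b_def)
  have nl: "r / 2 * (R - 2 * \<theta>) \<le> norm ((r / 2) *\<^sub>R l)" using l r by (simp add: mult_left_mono)
  have "r / 2 * (R - 2 * \<theta>) \<le> R * \<bar>a - u 0\<bar> + \<theta> * r"
    using norm_triangle_ineq4[of "F a - F (u 0)" "F a - F (u 0) - (r / 2) *\<^sub>R l"] F[of a "u 0"] da nl by simp
  moreover have "r / 2 * (R - 2 * \<theta>) \<le> R * \<bar>b - u 0\<bar> + \<theta> * r"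
    using norm_triangle_ineq4[of "F b - F (u 0) + (r / 2) *\<^sub>R l" "F b - F (u 0)"] F[of b "u 0"] db nl by simp
  ultimately have speed: "R * (r / 2) - 2 * \<theta> * r \<le> R * \<bar>a - u 0\<bar>" "R * (r / 2) - 2 * \<theta> * r \<le> R * \<bar>b - u 0\<bar>"
    by (simp_all add: algebra_simps)
  have big: "200 * \<theta> * r \<le> R * r" "0 < \<theta> * r" using \<theta> r by (auto intro: mult_right_mono)
  have ab: "\<bar>a - u 0\<bar> \<le> r / 2" "\<bar>b - u 0\<bar> \<le> r / 2"
    using u[of "r / 2" 0] u[of "- (r / 2)" 0] r by (auto simp: a_def b_def)
  have ne: "a \<noteq> u 0" "b \<noteq> u 0" using speed big by auto
  \<comment> \<open>If \<open>u\<close> turned back at 0, then \<open>a\<close> and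
    \<open>b\<close>, both almost r/2 away from \<open>u 0\<close> on the same side, would nearly
    coincide, while \<open>F a\<close> and \<open>F b\<close> differ by about \<open>r\<close> times
    \<open>l\<close>.\<close>
  have "\<not> (u 0 < a \<longleftrightarrow> u 0 < b)"
  proof
    assume "u 0 < a \<longleftrightarrow> u 0 < b"
    then have "\<bar>a - b\<bar> \<le> r / 2 - \<bar>a - u 0\<bar> \<or> \<bar>a - b\<bar> \<le> r / 2 - \<bar>b - u 0\<bar>"
      using ab by linarith
    then have "R * \<bar>a - b\<bar> \<le> R * (r / 2 - \<bar>a - u 0\<bar>) \<or> R * \<bar>a - b\<bar> \<le> R * (r / 2 - \<bar>b - u 0\<bar>)"
      using \<theta> by (auto intro: mult_left_mono)
    then have "R * \<bar>a - b\<bar> \<le> 2 * \<theta> * r" using speed by (auto simp: right_diff_distrib)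
    then have Fab: "norm (F a - F b) \<le> 2 * \<theta> * r" using F[of a b] by linarith
    have "r *\<^sub>R l = (F a - F b) - (F a - F (u 0) - (r / 2) *\<^sub>R l) + (F b - F (u 0) + (r / 2) *\<^sub>R l)"
      by (simp flip: scaleR_add_left)
    also have "norm \<dots> \<le> norm (F a - F b) + norm (F a - F (u 0) - (r / 2) *\<^sub>R l) + norm (F b - F (u 0) + (r / 2) *\<^sub>R l)"
      by (rule order_trans[OF norm_triangle_ineq add_right_mono[OF norm_triangle_ineq4]])
    also have "\<dots> \<le> 4 * \<theta> * r" using Fab da db by linarith
    finally have "r * norm l \<le> 4 * \<theta> * r" using r by simp
    then show False using l(1) \<theta> r by simp
  qed
  then consider "u (- (r / 2)) < u 0" "u 0 < u (r / 2)" | "u (r / 2) < u 0" "u 0 < u (- (r / 2))"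
    using ne unfolding a_def b_def by linarith
  then show thesis
  proof cases
    case 1
    show thesis
      by (rule that[OF refl]) (rule inner_derivative_increasing[OF F u deriv l \<theta> r 1])
  next
    case 2
    have "norm (F v - F (u 0) - (v - u 0) *\<^sub>R (- l)) \<le> 20 * \<theta> * \<bar>v - u 0\<bar>" if "\<bar>v - u 0\<bar> < r / 4" for v
    proof -
      have "\<bar>u (- s) - u (- t)\<bar> \<le> \<bar>s - t\<bar>" for s t using u[of "- s" "- t"] by simp
      moreover have "norm (F (u (- t)) - F (u (- 0)) - t *\<^sub>R (- l)) \<le> 2 * \<theta> * \<bar>t\<bar>" if "\<bar>t\<bar> < r" for t
        using deriv[of "- t"] that by simp
      ultimately show ?thesis
        using inner_derivative_increasing[of F R "\<lambda>t. u (- t)" r "- l" \<theta> v] F l \<theta> r 2 that by simp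
    qed
    then show thesis by (intro that[of "- l"]) auto
  qed
qed

section \<open>The map that cannot be approximated\<close>

lemma not_dense_if_not_dentable:
  fixes D :: "'b::banach set"
  assumes X: "\<exists>x::'a::real_normed_vector. x \<noteq> 0"
    and D: "bounded D" "D \<noteq> {}" "\<not> dentable D"
  shows "\<not> dense_in_Lip0 (SNA \<union> Der :: ('a \<Rightarrow> 'b) set)"
proof
  assume dense: "dense_in_Lip0 (SNA \<union> Der :: ('a \<Rightarrow> 'b) set)"
  obtain U split \<epsilon> R where "bush (U :: 'b set) split \<epsilon> R" and pos: "0 < \<epsilon>" "0 < R"
    and sup: "\<And>\<eta>. 0 < \<eta> \<Longrightarrow> \<exists>d\<in>U. R - \<eta> < norm d"
    by (rule not_dentable_imp_bush[OF D]) blast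
  then interpret bush U split \<epsilon> R by simp
  \<comment> \<open>\<open>inner_derivative\<close> needs \<open>200 * \<theta> \<le> R\<close> and
    worsens the error to \<open>20 * \<theta>\<close>; twice that must stay below
    \<open>\<epsilon>\<close> in \<open>G_no_derivative\<close>.\<close>
  define \<theta> where "\<theta> = min \<epsilon> R / 200"
  have \<theta>: "0 < \<theta>" "200 * \<theta> \<le> R" "200 * \<theta> \<le> \<epsilon>" using pos by (auto simp: \<theta>_def)
  obtain z where z: "z \<in> U" "R - \<theta> < norm z" using sup[OF \<theta>(1)] by blast
  define F where "F = G z"
  define f :: "'a \<Rightarrow> 'b" where "f x = F (norm x)" for x
  have F: "norm (F a - F b) \<le> R * \<bar>a - b\<bar>" for a b
    unfolding F_def by (rule profile_lipschitz_abs[OF profile_G[OF z(1)]])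
  have f: "norm (f p - f q) \<le> R * norm (p - q)" for p q
  proof -
    have "norm (f p - f q) \<le> R * \<bar>norm p - norm q\<bar>" unfolding f_def by (rule F)
    also have "\<dots> \<le> R * norm (p - q)" using pos by (intro mult_left_mono norm_triangle_ineq3) auto
    finally show ?thesis .
  qed
  have F01: "F 0 = 0" "F 1 = z"
    using profile_G[OF z(1)] by (auto simp: F_def profile_left profile_right)
  have lip_f: "R-lipschitz_on UNIV f" using f pos by (auto intro: lipschitz_onI simp: dist_norm)
  then have "f \<in> Lip0" using F01 by (auto simp: Lip0_def f_def)
  then obtain g where g: "g \<in> SNA \<union> Der" "lip_norm (\<lambda>x. f x - g x) < \<theta>"
    using dense \<theta>(1) unfolding dense_in_Lip0_def by blast
  then obtain K where lip_g: "K-lipschitz_on UNIV g" by (auto simp: SNA_def Der_def Lip0_def)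
  have close: "norm ((f p - g p) - (f q - g q)) \<le> \<theta> * norm (p - q)" for p q
  proof (cases "p = q")
    case False
    from lip_norm_upper[OF lipschitz_on_diff[OF lip_f lip_g] False]
    have "norm ((f p - g p) - (f q - g q)) \<le> lip_norm (\<lambda>x. f x - g x) * norm (p - q)" .
    also have "\<dots> \<le> \<theta> * norm (p - q)" using g(2) by (intro mult_right_mono) auto
    finally show ?thesis .
  qed simp
  define L where "L = lip_norm g"
  have gL: "norm (g p - g q) \<le> L * norm (p - q)" for p q
    using lip_norm_upper[OF lip_g, of p q] by (cases "p = q") (auto simp: L_def)
  have fg: "norm (f p - f q) \<le> norm (g p - g q) + \<theta> * norm (p - q)"
    "norm (g p - g q) \<le> norm (f p - f q) + \<theta> * norm (p - q)" for p q
    using close[of p q] norm_triangle_ineq[of "g p - g q" "(f p - g p) - (f q - g q)"]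
      norm_triangle_ineq4[of "f p - f q" "(f p - g p) - (f q - g q)"] by (auto simp: algebra_simps)
  have L_upper: "L \<le> R + \<theta>"
    unfolding L_def
  proof (rule lip_norm_least[OF X])
    show "norm (g p - g q) \<le> (R + \<theta>) * norm (p - q)" for p q
      using fg(2)[of p q] f[of p q] by (simp add: algebra_simps)
  qed
  have L_lower: "R - 2 * \<theta> \<le> L"
  proof -
    \<comment> \<open>Between the origin and a unit vector \<open>f\<close> moves from 0 to
      \<open>z\<close>, whose norm is almost \<open>R\<close>.\<close>
    obtain x :: 'a where "x \<noteq> 0" using X by blast
    then have "norm (x /\<^sub>R norm x) = 1" by simp
    then have "norm z \<le> L + \<theta>"
      using fg(1)[of "x /\<^sub>R norm x" 0] gL[of "x /\<^sub>R norm x" 0] by (simp add: f_def F01)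
    then show ?thesis using z(2) by simp
  qed
  from g(1) show False
  proof
    assume "g \<in> SNA"
    then obtain p q where pq: "p \<noteq> q" "norm (g p - g q) = L * norm (p - q)"
      by (auto simp: SNA_def L_def)
    define c where "c t = p + t *\<^sub>R (q - p)" for t :: real
    define u where "u t = norm (c t)" for t
    \<comment> \<open>On every subsegment from \<open>p\<close> to \<open>q\<close> the map
      \<open>g\<close> gains its full rate \<open>L\<close>, and \<open>f - g\<close> has rate at
      most \<open>\<theta>\<close>, so \<open>f\<close> still moves.\<close>
    have inj: "F (u s) \<noteq> F (u t)" if "0 \<le> s" "s < t" "t \<le> 1" for s t
    proof -
      have "c t - c s = (t - s) *\<^sub>R (q - p)" by (simp add: c_def algebra_simps)
      then have nc: "norm (c t - c s) = (t - s) * norm (p - q)" using that by (simp add: norm_minus_commute)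
      have "L * (t - s) * norm (p - q) \<le> norm (g (c t) - g (c s))"
        unfolding c_def using that by (intro strongly_attaining_segment gL pq) auto
      then have "(L - \<theta>) * ((t - s) * norm (p - q)) \<le> norm (f (c t) - f (c s))"
        using fg(2)[of "c t" "c s", unfolded nc] by (simp add: algebra_simps)
      moreover have "0 < (L - \<theta>) * ((t - s) * norm (p - q))"
        using L_lower \<theta> that pq(1) by (intro mult_pos_pos) auto
      ultimately show ?thesis by (auto simp: f_def u_def)
    qed
    have cont: "continuous_on A u" for A unfolding u_def c_def by (intro continuous_intros)
    \<comment> \<open>\<open>u\<close> sweeps the whole interval between \<open>u 0\<close> and
      \<open>u 1\<close>, so \<open>inj\<close> would make \<open>F\<close> injective there.\<close>
    have hit: "\<exists>t\<in>{0..1}. u t = v" if "min (u 0) (u 1) < v" "v < max (u 0) (u 1)" for v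
      using IVT'[of u 0 v 1] IVT2'[of u 1 v 0] cont that by (fastforce simp: min_def max_def split: if_splits)
    have "u 0 \<noteq> u 1" using inj[of 0 1] by auto
    then have "min (u 0) (u 1) < max (u 0) (u 1)" by auto
    then obtain a b where ab: "min (u 0) (u 1) < a" "a < b" "b < max (u 0) (u 1)" "F a = F b"
      using G_not_injective[OF z(1)] unfolding F_def by metis
    then obtain s t where "s \<in> {0..1}" "t \<in> {0..1}" "u s = a" "u t = b"
      using hit[of a] hit[of b] by auto
    then show False using inj[of s t] inj[of t s] ab by (cases s t rule: linorder_cases) auto
  next
    assume "g \<in> Der"
    then obtain x e l where e: "norm e = 1" and lim: "((\<lambda>t::real. (g (x + t *\<^sub>R e) - g x) /\<^sub>R t) \<longlongrightarrow> l) (at 0)"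
      and l: "norm l = L"
      by (auto simp: Der_def L_def)
    obtain r where r: "0 < r"
      "\<And>t. t \<noteq> 0 \<Longrightarrow> \<bar>t\<bar> < r \<Longrightarrow> norm ((g (x + t *\<^sub>R e) - g x) /\<^sub>R t - l) < \<theta>"
      using LIM_D[OF lim \<theta>(1)] by auto
    define u where "u t = norm (x + t *\<^sub>R e)" for t
    have u: "\<bar>u a - u b\<bar> \<le> \<bar>a - b\<bar>" for a b
      using norm_triangle_ineq3[of "x + a *\<^sub>R e" "x + b *\<^sub>R e"] e by (simp add: u_def flip: scaleR_diff_left)
    \<comment> \<open>One \<open>\<theta>\<close> comes from the derivative of \<open>g\<close>, the
      other from the difference of \<open>f\<close> and \<open>g\<close>.\<close>
    have deriv: "norm (F (u t) - F (u 0) - t *\<^sub>R l) \<le> 2 * \<theta> * \<bar>t\<bar>" if "\<bar>t\<bar> < r" for t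
    proof (cases "t = 0")
      case False
      have "g (x + t *\<^sub>R e) - g x - t *\<^sub>R l = t *\<^sub>R ((g (x + t *\<^sub>R e) - g x) /\<^sub>R t - l)"
        using False by (simp add: scaleR_diff_right)
      then have "norm (g (x + t *\<^sub>R e) - g x - t *\<^sub>R l) = norm ((g (x + t *\<^sub>R e) - g x) /\<^sub>R t - l) * \<bar>t\<bar>"
        by simp
      also have "\<dots> \<le> \<theta> * \<bar>t\<bar>" using r(2)[OF False that] by (intro mult_right_mono) auto
      finally have "norm (g (x + t *\<^sub>R e) - g x - t *\<^sub>R l) \<le> \<theta> * \<bar>t\<bar>" .
      moreover have "norm ((f (x + t *\<^sub>R e) - g (x + t *\<^sub>R e)) - (f x - g x)) \<le> \<theta> * \<bar>t\<bar>"
        using close[of "x + t *\<^sub>R e" x] e by simp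
      moreover have "F (u t) - F (u 0) - t *\<^sub>R l
          = ((f (x + t *\<^sub>R e) - g (x + t *\<^sub>R e)) - (f x - g x)) + (g (x + t *\<^sub>R e) - g x - t *\<^sub>R l)"
        by (simp add: f_def u_def)
      ultimately show ?thesis
        using norm_triangle_ineq[of "(f (x + t *\<^sub>R e) - g (x + t *\<^sub>R e)) - (f x - g x)" "g (x + t *\<^sub>R e) - g x - t *\<^sub>R l"]
        by simp
    qed simp
    obtain l' where l': "norm l' = L" "\<And>v. \<bar>v - u 0\<bar> < r / 4 \<Longrightarrow>
        norm (F v - F (u 0) - (v - u 0) *\<^sub>R l') \<le> 20 * \<theta> * \<bar>v - u 0\<bar>"
      using inner_derivative[of F R u r l \<theta>] F u deriv l L_lower L_upper \<theta>(1,2) r(1) by metis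
    show False
    proof (rule G_no_derivative[OF z(1)])
      show "2 * (20 * \<theta>) < \<epsilon>" "20 * \<theta> < norm l'" "0 < r / 4"
        using \<theta> L_lower l'(1) r(1) by auto
      show "norm (G z y - G z (u 0) - (y - u 0) *\<^sub>R l') \<le> 20 * \<theta> * \<bar>y - u 0\<bar>" if "\<bar>y - u 0\<bar> < r / 4" for y
        using l'(2)[OF that] by (simp add: F_def)
    qed
  qed
qed

theorem theorem2p13:
  assumes "\<exists>y::'b::banach. y \<noteq> 0"
    and "\<exists>x::'a::banach. x \<noteq> 0"
    and "dense_in_Lip0 (SNA \<union> Der :: ('a \<Rightarrow> 'b) set)"
  shows "extremal_RNP TYPE('b)"
  unfolding extremal_RNP_def farthest_point_def
  \<comment> \<open>A farthest point lies in \<open>D\<close>, so \<open>D\<close> is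
    nonempty.\<close>
  using not_dense_if_not_dentable[OF assms(2)] assms(3) by blast

end
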